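(* Let $\mathcal{T}$ be the 4-dimensional space of plane triangles modulo parallel translations, with the symplectic form induced by $\omega$. The vector field $\xi$ on $\mathcal{T}$ is completely (Liouville) integrable: it has Poisson commuting integrals, namely the perimeter and the (signed) area of a triangle. Moreover, the relation $\stackrel{t}{\sim}$ has a conserved quantity, independent of $t$, the area of a triangle: for every $t>0$, if $\mathbf{Q} \stackrel{t}{\sim} \mathbf{R}$, then the triangles $\mathbf{Q}$ and $\mathbf{R}$ have the same (signed) area.
   Context: A triangle is a triple $\mathbf{P}=(P_1,P_2,P_3)$ of points $P_i=(x_i,y_i)\in\mathbb{R}^2$ with pairwise distinct vertices (so the formulas below make sense); indices are cyclic mod 3. The 2-form is $\omega=\sum_{1\le i<j\le 3}(-1)^{i+j-1}(dx_i\wedge dx_j+dy_i\wedge dy_j)$ on the space of triangles; it has kernel spanned by the diagonal parallel translations and so induces a symplectic form on the quotient $\mathcal{T}$ of the space of triangles by parallel translations. The vector field $\xi=(\xi_1,\xi_2,\xi_3)$ moves the vertex $P_i$ with velocity $$\xi_i=\frac12\left(\frac{P_i-P_{i-1}}{|P_i-P_{i-1}|}-\frac{P_i-P_{i+1}}{|P_i-P_{i+1}|}\right);$$ it is translation invariant and so descends to $\mathcal{T}$. For $t>0$ let $q_t(\mathbf{P})=\mathbf{Q}$, $r_t(\mathbf{P})=\mathbf{R}$ with $$Q_i=P_i+t\frac{P_i-P_{i-1}}{|P_i-P_{i-1}|},\qquad R_i=P_i+t\frac{P_i-P_{i+1}}{|P_i-P_{i+1}|}.$$ One writes $\mathbf{Q}\stackrel{t}{\sim}\mathbf{R}$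 if there is a triangle $\mathbf{P}$ with $\mathbf{Q}=q_t(\mathbf{P})$ and $\mathbf{R}=r_t(\mathbf{P})$. Liouville integrable, on a symplectic manifold of dimension $2d$, means: the vector field is Hamiltonian and has $d$ integrals that pairwise Poisson commute and are functionally independent on a dense open set (here $d=2$). *)

theory Defs
  imports "HOL-Analysis.Analysis"
begin

section \<open>Smooth functions, symplectic forms and Liouville integrability on open sets\<close>

primrec Ck_on ::
  "nat \<Rightarrow> ('a::euclidean_space \<Rightarrow> 'b::real_normed_vector) \<Rightarrow> 'a set \<Rightarrow> bool" where
  "Ck_on 0 f U \<longleftrightarrow> continuous_on U f"
| "Ck_on (Suc k) f U \<longleftrightarrow>
     (\<forall>x\<in>U. f differentiable (at x)) \<and>
     (\<forall>v. Ck_on k (\<lambda>x. frechet_derivative f (at x) v) U)"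

definition smooth_on :: "('a::euclidean_space \<Rightarrow> 'b::real_normed_vector) \<Rightarrow> 'a set \<Rightarrow> bool" where
  "smooth_on f U \<longleftrightarrow> (\<forall>k. Ck_on k f U)"

text \<open>All manifolds here are open subsets \<open>M\<close> of a Euclidean space, which then also serves
  as the tangent space at every point; \<open>\<Omega> p u v\<close> is the value of a 2-form at the point \<open>p\<close> on
  the tangent vectors \<open>u\<close> and \<open>v\<close>. The last clause is the vanishing of the exterior derivative,
  evaluated on constant vector fields.\<close>

definition symplectic_form_on ::
  "'a::euclidean_space set \<Rightarrow> ('a \<Rightarrow> 'a \<Rightarrow> 'a \<Rightarrow> real) \<Rightarrow> bool" where
  "symplectic_form_on M \<Omega> \<longleftrightarrow>
     open M \<and>
     (\<forall>p\<in>M. bilinear (\<Omega> p)) \<and>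
     (\<forall>p\<in>M. \<forall>v. \<Omega> p v v = 0) \<and>
     (\<forall>p\<in>M. \<forall>u. (\<forall>v. \<Omega> p u v = 0) \<longrightarrow> u = 0) \<and>
     (\<forall>u v. smooth_on (\<lambda>p. \<Omega> p u v) M) \<and>
     (\<forall>p\<in>M. \<forall>u v w.
        frechet_derivative (\<lambda>q. \<Omega> q v w) (at p) u
      - frechet_derivative (\<lambda>q. \<Omega> q u w) (at p) v
      + frechet_derivative (\<lambda>q. \<Omega> q u v) (at p) w = 0)"

definition is_hamiltonian_field ::
  "'a::euclidean_space set \<Rightarrow> ('a \<Rightarrow> 'a \<Rightarrow> 'a \<Rightarrow> real) \<Rightarrow> ('a \<Rightarrow> real) \<Rightarrow> ('a \<Rightarrow> 'a) \<Rightarrow> bool" where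
  "is_hamiltonian_field M \<Omega> H X \<longleftrightarrow>
     smooth_on H M \<and> (\<forall>p\<in>M. \<forall>v. \<Omega> p (X p) v = frechet_derivative H (at p) v)"

definition hamiltonian_vector ::
  "('a::euclidean_space \<Rightarrow> 'a \<Rightarrow> 'a \<Rightarrow> real) \<Rightarrow> ('a \<Rightarrow> real) \<Rightarrow> 'a \<Rightarrow> 'a" where
  "hamiltonian_vector \<Omega> F p = (THE u. \<forall>v. \<Omega> p u v = frechet_derivative F (at p) v)"

definition poisson_bracket ::
  "('a::euclidean_space \<Rightarrow> 'a \<Rightarrow> 'a \<Rightarrow> real) \<Rightarrow> ('a \<Rightarrow> real) \<Rightarrow> ('a \<Rightarrow> real) \<Rightarrow> 'a \<Rightarrow> real" where
  "poisson_bracket \<Omega> F G p = \<Omega> p (hamiltonian_vector \<Omega> F p) (hamiltonian_vector \<Omega> G p)"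

definition is_integral ::
  "'a::euclidean_space set \<Rightarrow> ('a \<Rightarrow> 'a) \<Rightarrow> ('a \<Rightarrow> real) \<Rightarrow> bool" where
  "is_integral M X F \<longleftrightarrow>
     smooth_on F M \<and> (\<forall>p\<in>M. frechet_derivative F (at p) (X p) = 0)"

definition differentials_independent_at ::
  "('a::euclidean_space \<Rightarrow> real) list \<Rightarrow> 'a \<Rightarrow> bool" where
  "differentials_independent_at Fs p \<longleftrightarrow>
     (\<forall>c :: nat \<Rightarrow> real.
        (\<forall>v. (\<Sum>i<length Fs. c i * frechet_derivative (Fs ! i) (at p) v) = 0)
        \<longrightarrow> (\<forall>i<length Fs. c i = 0))"

definition liouville_integrable_by ::
  "'a::euclidean_space set \<Rightarrow> ('a \<Rightarrow> 'a \<Rightarrow> 'a \<Rightarrow> real) \<Rightarrow> ('a \<Rightarrow> 'a) \<Rightarrow> ('a \<Rightarrow> real) list \<Rightarrow> bool"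
  where
  "liouville_integrable_by M \<Omega> X Fs \<longleftrightarrow>
     symplectic_form_on M \<Omega> \<and>
     DIM('a) = 2 * length Fs \<and>
     (\<exists>H. is_hamiltonian_field M \<Omega> H X) \<and>
     (\<forall>F\<in>set Fs. is_integral M X F) \<and>
     (\<forall>F\<in>set Fs. \<forall>G\<in>set Fs. \<forall>p\<in>M. poisson_bracket \<Omega> F G p = 0) \<and>
     (\<exists>W. open W \<and> W \<subseteq> M \<and> M \<subseteq> closure W \<and> (\<forall>p\<in>W. differentials_independent_at Fs p))"


section \<open>Triangles\<close>

text \<open>The index type \<open>3\<close> has the elements \<open>1\<close>, \<open>2\<close>, \<open>3 = 0\<close> and arithmetic modulo 3.\<close>

type_synonym triple = "(real^2)^3"

definition triangles :: "triple set" where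
  "triangles = {P. \<forall>i j. i \<noteq> j \<longrightarrow> P $ i \<noteq> P $ j}"

definition wedge :: "('a \<Rightarrow> real) \<Rightarrow> ('a \<Rightarrow> real) \<Rightarrow> 'a \<Rightarrow> 'a \<Rightarrow> real" where
  "wedge \<alpha> \<beta> v w = \<alpha> v * \<beta> w - \<alpha> w * \<beta> v"

definition dx :: "nat \<Rightarrow> triple \<Rightarrow> real" where
  "dx i v = v $ of_nat i $ 1"

definition dy :: "nat \<Rightarrow> triple \<Rightarrow> real" where
  "dy i v = v $ of_nat i $ 2"

definition omega :: "triple \<Rightarrow> triple \<Rightarrow> real" where
  "omega v w = (\<Sum>j\<in>{1..3}. \<Sum>i\<in>{1..<j}.
     (-1) ^ (i + j - 1) * (wedge (dx i) (dx j) v w + wedge (dy i) (dy j) v w))"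

definition xi :: "triple \<Rightarrow> triple" where
  "xi P = (\<chi> i. (1/2) *\<^sub>R
     ((P $ i - P $ (i - 1)) /\<^sub>R norm (P $ i - P $ (i - 1))
    - (P $ i - P $ (i + 1)) /\<^sub>R norm (P $ i - P $ (i + 1))))"

definition perimeter :: "triple \<Rightarrow> real" where
  "perimeter P = (\<Sum>i\<in>UNIV. dist (P $ i) (P $ (i + 1)))"

definition signed_area :: "triple \<Rightarrow> real" where
  "signed_area P = (1/2) * (\<Sum>i\<in>UNIV. P $ i $ 1 * P $ (i + 1) $ 2 - P $ (i + 1) $ 1 * P $ i $ 2)"

definition q_map :: "real \<Rightarrow> triple \<Rightarrow> triple" where
  "q_map t P = (\<chi> i. P $ i + t *\<^sub>R ((P $ i - P $ (i - 1)) /\<^sub>R norm (P $ i - P $ (i - 1))))"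

definition r_map :: "real \<Rightarrow> triple \<Rightarrow> triple" where
  "r_map t P = (\<chi> i. P $ i + t *\<^sub>R ((P $ i - P $ (i + 1)) /\<^sub>R norm (P $ i - P $ (i + 1))))"

definition t_related :: "real \<Rightarrow> triple \<Rightarrow> triple \<Rightarrow> bool" where
  "t_related t Q R \<longleftrightarrow> (\<exists>P\<in>triangles. Q = q_map t P \<and> R = r_map t P)"


section \<open>The quotient by parallel translations\<close>

definition translation_equiv :: "triple \<Rightarrow> triple \<Rightarrow> bool" where
  "translation_equiv P Q \<longleftrightarrow> (\<exists>c. \<forall>i. Q $ i = P $ i + c)"

lemma translation_equiv_refl: "translation_equiv P P"
  unfolding translation_equiv_def by (rule exI[of _ 0]) simp

lemma equivp_translation_equiv: "equivp translation_equiv"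
proof (rule equivpI)
  show "reflp translation_equiv"
    by (rule reflpI) (rule translation_equiv_refl)
  show "symp translation_equiv"
  proof (rule sympI)
    fix P Q assume "translation_equiv P Q"
    then obtain c where "\<forall>i. Q $ i = P $ i + c"
      unfolding translation_equiv_def by blast
    then show "translation_equiv Q P"
      unfolding translation_equiv_def by (intro exI[of _ "-c"]) simp
  qed
  show "transp translation_equiv"
  proof (rule transpI)
    fix P Q R assume "translation_equiv P Q" "translation_equiv Q R"
    then obtain c d where "\<forall>i. Q $ i = P $ i + c" "\<forall>i. R $ i = Q $ i + d"
      unfolding translation_equiv_def by blast
    then show "translation_equiv P R"
      unfolding translation_equiv_def by (intro exI[of _ "c + d"]) (simp add: add.assoc)
  qed
qed

quotient_type triple_mod = "(real^2)^3" / translation_equiv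
  by (rule equivp_translation_equiv)

instantiation triple_mod :: real_vector
begin

lift_definition zero_triple_mod :: triple_mod is 0 .

lift_definition plus_triple_mod :: "triple_mod \<Rightarrow> triple_mod \<Rightarrow> triple_mod" is "(+)"
proof -
  fix P P' Q Q' assume "translation_equiv P P'" "translation_equiv Q Q'"
  then obtain c d where "\<forall>i. P' $ i = P $ i + c" "\<forall>i. Q' $ i = Q $ i + d"
    unfolding translation_equiv_def by blast
  then show "translation_equiv (P + Q) (P' + Q')"
    unfolding translation_equiv_def by (intro exI[of _ "c + d"]) simp
qed

lift_definition minus_triple_mod :: "triple_mod \<Rightarrow> triple_mod \<Rightarrow> triple_mod" is "(-)"
proof -
  fix P P' Q Q' assume "translation_equiv P P'" "translation_equiv Q Q'"
  then obtain c d where "\<forall>i. P' $ i = P $ i + c" "\<forall>i. Q' $ i = Q $ i + d"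
    unfolding translation_equiv_def by blast
  then show "translation_equiv (P - Q) (P' - Q')"
    unfolding translation_equiv_def by (intro exI[of _ "c - d"]) simp
qed

lift_definition uminus_triple_mod :: "triple_mod \<Rightarrow> triple_mod" is uminus
proof -
  fix P P' assume "translation_equiv P P'"
  then obtain c where "\<forall>i. P' $ i = P $ i + c"
    unfolding translation_equiv_def by blast
  then show "translation_equiv (- P) (- P')"
    unfolding translation_equiv_def by (intro exI[of _ "- c"]) simp
qed

lift_definition scaleR_triple_mod :: "real \<Rightarrow> triple_mod \<Rightarrow> triple_mod" is scaleR
proof -
  fix a P P' assume "translation_equiv P P'"
  then obtain c where "\<forall>i. P' $ i = P $ i + c"
    unfolding translation_equiv_def by blast
  then show "translation_equiv (a *\<^sub>R P) (a *\<^sub>R P')"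
    unfolding translation_equiv_def by (intro exI[of _ "a *\<^sub>R c"]) (simp add: scaleR_right_distrib)
qed

instance
  by standard (transfer; simp add: algebra_simps translation_equiv_refl)+

end

text \<open>The inner product is auxiliary: on a finite-dimensional real vector space every inner product
  induces the same topology and the same derivatives, and nothing else of it is used.\<close>

instantiation triple_mod :: real_inner
begin

lift_definition inner_triple_mod :: "triple_mod \<Rightarrow> triple_mod \<Rightarrow> real" is
  "\<lambda>v w. (v $ 2 - v $ 1) \<bullet> (w $ 2 - w $ 1) + (v $ 3 - v $ 1) \<bullet> (w $ 3 - w $ 1)"
  by (auto simp: translation_equiv_def)

definition norm_triple_mod :: "triple_mod \<Rightarrow> real" where
  "norm_triple_mod v = sqrt (v \<bullet> v)"

definition dist_triple_mod :: "triple_mod \<Rightarrow> triple_mod \<Rightarrow> real" where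
  "dist_triple_mod v w = norm (v - w)"

definition sgn_triple_mod :: "triple_mod \<Rightarrow> triple_mod" where
  "sgn_triple_mod v = v /\<^sub>R norm v"

definition uniformity_triple_mod :: "(triple_mod \<times> triple_mod) filter" where
  "uniformity_triple_mod = (INF e\<in>{0<..}. principal {(v, w). dist v w < e})"

definition open_triple_mod :: "triple_mod set \<Rightarrow> bool" where
  "open_triple_mod U \<longleftrightarrow> (\<forall>v\<in>U. eventually (\<lambda>(v', w). v' = v \<longrightarrow> w \<in> U) uniformity)"

instance
proof
  fix u v w :: triple_mod and a :: real and U :: "triple_mod set"
  show "sgn v = v /\<^sub>R norm v" by (rule sgn_triple_mod_def)
  show "dist v w = norm (v - w)" by (rule dist_triple_mod_def)
  show "(uniformity :: (triple_mod \<times> triple_mod) filter)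
      = (INF e\<in>{0<..}. principal {(v, w). dist v w < e})"
    by (rule uniformity_triple_mod_def)
  show "open U \<longleftrightarrow> (\<forall>v\<in>U. \<forall>\<^sub>F (v', w) in uniformity. v' = v \<longrightarrow> w \<in> U)"
    by (rule open_triple_mod_def)
  show "v \<bullet> w = w \<bullet> v"
    by transfer (simp add: inner_commute)
  show "(u + v) \<bullet> w = u \<bullet> w + v \<bullet> w"
    by transfer (simp add: inner_diff_left inner_add_left)
  show "(a *\<^sub>R v) \<bullet> w = a * (v \<bullet> w)"
    by transfer (simp add: inner_diff_left algebra_simps)
  show "0 \<le> v \<bullet> v"
    by transfer simp
  show "v \<bullet> v = 0 \<longleftrightarrow> v = 0"
  proof transfer
    fix v :: triple
    have "(v $ 2 - v $ 1) \<bullet> (v $ 2 - v $ 1) + (v $ 3 - v $ 1) \<bullet> (v $ 3 - v $ 1) = 0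
        \<longleftrightarrow> v $ 2 = v $ 1 \<and> v $ 3 = v $ 1"
      by (simp add: add_nonneg_eq_0_iff)
    also have "\<dots> \<longleftrightarrow> translation_equiv v 0"
    proof
      assume "v $ 2 = v $ 1 \<and> v $ 3 = v $ 1"
      then show "translation_equiv v 0"
        unfolding translation_equiv_def forall_3 by (intro exI[of _ "- v $ 1"]) simp
    next
      assume "translation_equiv v 0"
      then obtain c where c: "\<And>i. v $ i + c = 0"
        unfolding translation_equiv_def by auto
      show "v $ 2 = v $ 1 \<and> v $ 3 = v $ 1"
        using c[of 1] c[of 2] c[of 3] by (metis add_right_cancel)
    qed
    finally show "(v $ 2 - v $ 1) \<bullet> (v $ 2 - v $ 1) + (v $ 3 - v $ 1) \<bullet> (v $ 3 - v $ 1) = 0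
        \<longleftrightarrow> translation_equiv v 0" .
  qed
  show "norm v = sqrt (v \<bullet> v)" by (rule norm_triple_mod_def)
qed

end

lemma axis_component: "axis k b $ i = (if i = k then b else 0)"
  by (simp add: axis_def)

lemma inner_abs_triple_mod_axis:
  "abs_triple_mod v \<bullet> abs_triple_mod (axis 2 b) = (v $ 2 - v $ 1) \<bullet> b"
  "abs_triple_mod v \<bullet> abs_triple_mod (axis 3 b) = (v $ 3 - v $ 1) \<bullet> b"
  by (simp_all add: inner_triple_mod.abs_eq axis_def)

instantiation triple_mod :: euclidean_space
begin

definition Basis_triple_mod :: "triple_mod set" where
  "Basis_triple_mod = (\<lambda>b. abs_triple_mod (axis 2 b)) ` Basis \<union> (\<lambda>b. abs_triple_mod (axis 3 b)) ` Basis"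

instance
proof
  show "(Basis :: triple_mod set) \<noteq> {}" "finite (Basis :: triple_mod set)"
    by (simp_all add: Basis_triple_mod_def)
next
  fix u v :: triple_mod assume uv: "u \<in> Basis" "v \<in> Basis"
  have zero: "b \<noteq> 0" if "b \<in> Basis" for b :: "real^2"
    using that by (rule nonzero_Basis)
  have ne: "abs_triple_mod (axis 2 b) \<noteq> abs_triple_mod (axis 3 b')"
    if "b \<in> Basis" "b' \<in> Basis" for b b' :: "real^2"
  proof
    assume "abs_triple_mod (axis 2 b) = abs_triple_mod (axis 3 b')"
    then have "abs_triple_mod (axis 2 b) \<bullet> abs_triple_mod (axis 2 b)
             = abs_triple_mod (axis 3 b') \<bullet> abs_triple_mod (axis 2 b)" by simp
    then have "b \<bullet> b = 0"
      unfolding inner_abs_triple_mod_axis by (simp add: axis_def)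
    then show False using zero that by simp
  qed
  have inj: "abs_triple_mod (axis k b) = abs_triple_mod (axis k b') \<longleftrightarrow> b = b'"
    if "b \<in> Basis" "b' \<in> Basis" "k = 2 \<or> k = 3" for b b' :: "real^2" and k :: 3
  proof
    assume "abs_triple_mod (axis k b) = abs_triple_mod (axis k b')"
    then have "abs_triple_mod (axis k b) \<bullet> abs_triple_mod (axis k b)
             = abs_triple_mod (axis k b') \<bullet> abs_triple_mod (axis k b)" by simp
    then have "b \<bullet> b = b' \<bullet> b"
      using that(3) unfolding inner_triple_mod.abs_eq by (auto simp: axis_def)
    then show "b = b'" using that by (simp add: inner_Basis split: if_splits)
  qed simp
  show "u \<bullet> v = (if u = v then 1 else 0)"
    using uv ne ne[symmetric] inj unfolding Basis_triple_mod_def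
    by (auto simp: inner_abs_triple_mod_axis axis_component inner_Basis)
next
  fix x :: triple_mod
  show "(\<forall>u\<in>Basis. x \<bullet> u = 0) \<longleftrightarrow> x = 0"
  proof
    assume *: "\<forall>u\<in>Basis. x \<bullet> u = 0"
    obtain v where x: "x = abs_triple_mod v"
      by (metis Quotient_triple_mod Quotient_abs_rep)
    have "\<forall>b\<in>Basis. (v $ 2 - v $ 1) \<bullet> b = 0" "\<forall>b\<in>Basis. (v $ 3 - v $ 1) \<bullet> b = 0"
      using * unfolding Basis_triple_mod_def x inner_abs_triple_mod_axis[symmetric] by blast+
    then have "v $ 2 - v $ 1 = 0" "v $ 3 - v $ 1 = 0"
      using euclidean_all_zero_iff by blast+
    then have "x \<bullet> x = 0"
      by (simp add: x inner_triple_mod.abs_eq)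
    then show "x = 0" by simp
  qed simp
qed

end

text \<open>The space of triangles modulo translations is the image of the (saturated) open set of
  triangles in the 4-dimensional quotient vector space.\<close>

definition triangle_space :: "triple_mod set" where
  "triangle_space = abs_triple_mod ` triangles"

lift_definition omega_mod :: "triple_mod \<Rightarrow> triple_mod \<Rightarrow> real" is omega
proof -
  fix v v' w w' assume "translation_equiv v v'" "translation_equiv w w'"
  then obtain c d where "\<forall>i. v' $ i = v $ i + c" "\<forall>i. w' $ i = w $ i + d"
    unfolding translation_equiv_def by blast
  then show "omega v w = omega v' w'"
    by (simp add: omega_def wedge_def dx_def dy_def numeral_3_eq_3 atLeastLessThanSuc
        sum.atLeast_Suc_atMost_Suc_shift algebra_simps)
qed

lift_definition xi_mod :: "triple_mod \<Rightarrow> triple_mod" is xi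
proof -
  fix P P' assume "translation_equiv P P'"
  then obtain c where "\<forall>i. P' $ i = P $ i + c"
    unfolding translation_equiv_def by blast
  then have "P' $ i - P' $ j = P $ i - P $ j" for i j
    by simp
  then have "xi P = xi P'"
    by (simp add: xi_def)
  then show "translation_equiv (xi P) (xi P')"
    using translation_equiv_refl by simp
qed

lift_definition perimeter_mod :: "triple_mod \<Rightarrow> real" is perimeter
  unfolding translation_equiv_def perimeter_def by (auto simp: dist_norm)

lift_definition signed_area_mod :: "triple_mod \<Rightarrow> real" is signed_area
proof -
  fix P P' assume "translation_equiv P P'"
  then obtain c where "\<forall>i. P' $ i = P $ i + c"
    unfolding translation_equiv_def by blast
  moreover have four: "(4::3) = 1"
    by simp
  ultimately show "signed_area P = signed_area P'"
    by (simp add: signed_area_def sum_3 four algebra_simps)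
qed

end

theory Submission
  imports Defs
begin

text \<open>In terms of the sides \<open>a = P\<^sub>2 - P\<^sub>1\<close> and \<open>b = P\<^sub>3 - P\<^sub>1\<close>, which are coordinates on the quotient, the
  2-form is \<open>da \<and> db\<close>, and \<open>\<xi>\<close> is the Hamiltonian field of half the perimeter. The area is constant
  along \<open>\<xi>\<close> because the side vectors change by multiples of the unit vectors along the sides and the
  contributions \<open>sgn (b - a) \<times> (b - a)\<close>, \<open>sgn a \<times> a\<close>, \<open>sgn b \<times> b\<close> vanish. If the differentials of
  perimeter and area are dependent, testing them on the variations \<open>(b, 0)\<close> and \<open>(0, a)\<close>, which
  do not change the area to first order, forces \<open>|a| = |b|\<close>.\<close>

section \<open>Closure properties of smooth functions\<close>

text \<open>Since \<open>U\<close> is open, the derivative at a point of \<open>U\<close> depends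
  only on values in \<open>U\<close>. Hence derivative formulas that are valid only on
  \<open>U\<close> may be used for the higher derivatives.\<close>

lemma Ck_on_cong:
  assumes "open U" "\<And>x. x \<in> U \<Longrightarrow> f x = g x" "Ck_on k f U"
  shows "Ck_on k g U"
  using assms(2,3)
proof (induction k arbitrary: f g)
  case 0
  then show ?case
    by (simp cong: continuous_on_cong)
next
  case (Suc k)
  have deriv: "(g has_derivative frechet_derivative f (at x)) (at x)" if "x \<in> U" for x
  proof (rule has_derivative_transform_within_open)
    show "(f has_derivative frechet_derivative f (at x)) (at x)"
      using Suc.prems(2) that by (simp add: frechet_derivative_works)
  qed (use assms(1) that Suc.prems(1) in auto)
  have "frechet_derivative f (at x) = frechet_derivative g (at x)" if "x \<in> U" for x
    using deriv[OF that] by (rule frechet_derivative_at)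
  then have "Ck_on k (\<lambda>x. frechet_derivative g (at x) v) U" for v
    using Suc.IH[of "\<lambda>x. frechet_derivative f (at x) v"] Suc.prems(2) by simp
  then show ?case
    using deriv by (auto simp: differentiable_def)
qed

text \<open>This is the common induction step below: an explicit derivative \<open>f'\<close>, known
  on \<open>U\<close>, stands in for \<open>frechet_derivative\<close>.\<close>

lemma Ck_on_SucI:
  assumes "open U" "\<And>x. x \<in> U \<Longrightarrow> (f has_derivative f' x) (at x)"
    and "\<And>v. Ck_on k (\<lambda>x. f' x v) U"
  shows "Ck_on (Suc k) f U"
proof -
  have "frechet_derivative f (at x) = f' x" if "x \<in> U" for x
    using frechet_derivative_at[OF assms(2)[OF that]] by simp
  then have "Ck_on k (\<lambda>x. frechet_derivative f (at x) v) U" for v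
    by (intro Ck_on_cong[OF assms(1) _ assms(3)[of v]]) simp
  then show ?thesis
    using assms(2) by (auto simp: differentiable_def)
qed

lemma Ck_on_Suc_has_derivative:
  assumes "Ck_on (Suc k) f U" "x \<in> U"
  shows "(f has_derivative frechet_derivative f (at x)) (at x)"
  using assms by (simp add: frechet_derivative_works)

text \<open>Product, quotient and root rules contain undifferentiated factors, whose regularity has
  to be lowered by one before the induction hypothesis applies.\<close>

lemma Ck_on_SucD:
  assumes "Ck_on (Suc k) f U"
  shows "Ck_on k f U"
  using assms
proof (induction k arbitrary: f)
  case 0
  then show ?case
    by (auto intro!: continuous_at_imp_continuous_on differentiable_imp_continuous_within)
next
  case (Suc k)
  show ?case
    using Suc.prems Suc.IH by (simp del: Ck_on.simps(1))
qed

lemma Ck_on_const: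
  assumes "open U"
  shows "Ck_on k (\<lambda>_. c) U"
proof (induction k arbitrary: c)
  case (Suc k)
  show ?case
    using assms Suc.IH[of 0] by (intro Ck_on_SucI[where f' = "\<lambda>_ _. 0"]) auto
qed simp

lemma Ck_on_linear:
  assumes "open U" "bounded_linear f"
  shows "Ck_on k f U"
proof (cases k)
  case 0
  then show ?thesis
    using assms(2) by (simp add: linear_continuous_on)
next
  case (Suc k')
  then show ?thesis
    using assms
    by (auto simp del: Ck_on.simps intro!: Ck_on_SucI[where f' = "\<lambda>_. f"] Ck_on_const
        bounded_linear_imp_has_derivative)
qed

lemma Ck_on_add:
  assumes "open U" "Ck_on k f U" "Ck_on k g U"
  shows "Ck_on k (\<lambda>x. f x + g x) U"
  using assms(2,3)
proof (induction k arbitrary: f g)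
  case 0
  then show ?case
    by (auto intro: continuous_on_add)
next
  case (Suc k)
  show ?case
  proof (rule Ck_on_SucI[OF assms(1)])
    show "((\<lambda>x. f x + g x) has_derivative
        (\<lambda>v. frechet_derivative f (at x) v + frechet_derivative g (at x) v)) (at x)"
      if "x \<in> U" for x
      using Suc.prems that by (intro has_derivative_add Ck_on_Suc_has_derivative)
    show "Ck_on k (\<lambda>x. frechet_derivative f (at x) v + frechet_derivative g (at x) v) U" for v
      using Suc by simp
  qed
qed

lemma Ck_on_mult:
  fixes f g :: "'a::euclidean_space \<Rightarrow> real"
  assumes "open U" "Ck_on k f U" "Ck_on k g U"
  shows "Ck_on k (\<lambda>x. f x * g x) U"
  using assms(2,3)
proof (induction k arbitrary: f g)
  case 0
  then show ?case
    by (auto intro: continuous_on_mult)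
next
  case (Suc k)
  show ?case
  proof (rule Ck_on_SucI[OF assms(1)])
    show "((\<lambda>x. f x * g x) has_derivative
        (\<lambda>v. f x * frechet_derivative g (at x) v + frechet_derivative f (at x) v * g x)) (at x)"
      if "x \<in> U" for x
      using Suc.prems that by (intro has_derivative_mult Ck_on_Suc_has_derivative)
    show "Ck_on k (\<lambda>x. f x * frechet_derivative g (at x) v + frechet_derivative f (at x) v * g x) U"
      for v
      using Suc.prems Ck_on_SucD[OF Suc.prems(1)] Ck_on_SucD[OF Suc.prems(2)]
      by (intro Ck_on_add Suc.IH assms(1)) simp_all
  qed
qed

text \<open>The derivative is a product of \<open>f'\<close> with two copies of the reciprocal
  itself, so induction on \<open>k\<close> closes up.\<close>

lemma Ck_on_inverse:
  fixes f :: "'a::euclidean_space \<Rightarrow> real"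
  assumes "open U" "\<And>x. x \<in> U \<Longrightarrow> f x \<noteq> 0" "Ck_on k f U"
  shows "Ck_on k (\<lambda>x. inverse (f x)) U"
  using assms(3)
proof (induction k)
  case 0
  then show ?case
    using assms(2) by (auto intro: continuous_on_inverse)
next
  case (Suc k)
  show ?case
  proof (rule Ck_on_SucI[OF assms(1)])
    show "((\<lambda>x. inverse (f x)) has_derivative
        (\<lambda>v. (- 1) * (inverse (f x) * frechet_derivative f (at x) v * inverse (f x)))) (at x)"
      if "x \<in> U" for x
      using Deriv.has_derivative_inverse[OF assms(2)[OF that] Ck_on_Suc_has_derivative[OF Suc.prems that]]
      by simp
    show "Ck_on k (\<lambda>x. (- 1) * (inverse (f x) * frechet_derivative f (at x) v * inverse (f x))) U"
      for v
      using Suc.prems Ck_on_SucD[OF Suc.prems]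
      by (intro Ck_on_mult Suc.IH Ck_on_const assms(1)) simp_all
  qed
qed

text \<open>The derivative is \<open>f'\<close> over twice the root. The induction hypothesis covers
  the root, and positivity keeps it away from 0, so that its reciprocal is regular too.\<close>

lemma Ck_on_sqrt:
  fixes f :: "'a::euclidean_space \<Rightarrow> real"
  assumes "open U" "\<And>x. x \<in> U \<Longrightarrow> f x > 0" "Ck_on k f U"
  shows "Ck_on k (\<lambda>x. sqrt (f x)) U"
  using assms(3)
proof (induction k)
  case 0
  then show ?case
    by (auto intro: continuous_on_real_sqrt)
next
  case (Suc k)
  show ?case
  proof (rule Ck_on_SucI[OF assms(1)])
    show "((\<lambda>x. sqrt (f x)) has_derivative
        (\<lambda>v. frechet_derivative f (at x) v * (inverse (sqrt (f x)) * (1/2)))) (at x)"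
      if "x \<in> U" for x
    proof -
      have "DERIV sqrt (f x) :> inverse (sqrt (f x)) / 2"
        using assms(2)[OF that] by (rule DERIV_real_sqrt)
      from DERIV_compose_FDERIV[OF this Ck_on_Suc_has_derivative[OF Suc.prems that]]
      show ?thesis by simp
    qed
    have "sqrt (f x) \<noteq> 0" if "x \<in> U" for x
      using assms(2)[OF that] by simp
    then show "Ck_on k (\<lambda>x. frechet_derivative f (at x) v * (inverse (sqrt (f x)) * (1/2))) U" for v
      using Suc.prems Suc.IH Ck_on_SucD[OF Suc.prems]
      by (intro Ck_on_mult Ck_on_inverse Ck_on_const assms(1)) simp_all
  qed
qed

lemma Ck_on_inner_linear:
  assumes "open U" "bounded_linear f" "bounded_linear g"
  shows "Ck_on k (\<lambda>x. f x \<bullet> (g x :: 'b::euclidean_space)) U"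
proof -
  \<comment> \<open>In coordinates the inner product is a sum of products of linear functionals.
    General finite \<open>B\<close> makes this an induction over the basis.\<close>
  have "Ck_on k (\<lambda>x. \<Sum>b\<in>B. (f x \<bullet> b) * (g x \<bullet> b)) U" if "finite B" for B
    using that
  proof (induction B rule: finite_induct)
    case empty
    show ?case using assms(1) by (simp add: Ck_on_const)
  next
    case (insert b B)
    have "Ck_on k (\<lambda>x. (f x \<bullet> b) * (g x \<bullet> b)) U"
      using assms by (intro Ck_on_mult Ck_on_linear bounded_linear_inner_left_comp)
    then show ?case
      using insert assms(1) by (simp add: Ck_on_add)
  qed
  from this[OF finite_Basis] show ?thesis
    by (simp flip: euclidean_inner)
qed

lemma Ck_on_norm_linear:
  fixes f :: "'a::euclidean_space \<Rightarrow> 'b::euclidean_space"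
  assumes "open U" "bounded_linear f" "\<And>x. x \<in> U \<Longrightarrow> f x \<noteq> 0"
  shows "Ck_on k (\<lambda>x. norm (f x)) U"
  unfolding norm_eq_sqrt_inner
  using assms by (intro Ck_on_sqrt Ck_on_inner_linear) auto

section \<open>Side coordinates on the quotient\<close>

lift_definition side2 :: "triple_mod \<Rightarrow> real^2" is "\<lambda>v. v $ 2 - v $ 1"
  by (auto simp: translation_equiv_def)

lift_definition side3 :: "triple_mod \<Rightarrow> real^2" is "\<lambda>v. v $ 3 - v $ 1"
  by (auto simp: translation_equiv_def)

text \<open>The chosen representative has its first vertex at the origin.\<close>

lift_definition of_sides :: "real^2 \<Rightarrow> real^2 \<Rightarrow> triple_mod" is
  "\<lambda>a b. axis 2 a + axis 3 b" .

lemma side_of_sides [simp]: "side2 (of_sides a b) = a" "side3 (of_sides a b) = b"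
  by (transfer; simp add: axis_def)+

lemma of_sides_side [simp]: "of_sides (side2 p) (side3 p) = p"
proof transfer
  fix P :: triple
  show "translation_equiv (axis 2 (P $ 2 - P $ 1) + axis 3 (P $ 3 - P $ 1)) P"
    unfolding translation_equiv_def forall_3
    by (intro exI[of _ "P $ 1"]) (simp add: axis_def)
qed

lemma triple_mod_eq_iff: "p = q \<longleftrightarrow> side2 p = side2 q \<and> side3 p = side3 q"
  by (metis of_sides_side)

lemma bounded_linear_side: "bounded_linear side2" "bounded_linear side3"
  unfolding linear_conv_bounded_linear[symmetric]
  by (rule linearI; transfer; simp add: algebra_simps)+

lemma side_add: "side2 (p + q) = side2 p + side2 q" "side3 (p + q) = side3 p + side3 q"
  and side_scaleR: "side2 (c *\<^sub>R p) = c *\<^sub>R side2 p" "side3 (c *\<^sub>R p) = c *\<^sub>R side3 p"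
  and side_zero: "side2 0 = 0" "side3 0 = 0"
  by (transfer; simp add: algebra_simps)+

text \<open>The two sides give a linear isomorphism onto the product of two planes.\<close>

lemma DIM_triple_mod: "DIM(triple_mod) = 4"
proof -
  let ?f = "\<lambda>p. (side2 p, side3 p)"
  have lin: "linear ?f"
    by (rule linearI) (simp_all add: side_add side_scaleR)
  have inj: "inj ?f"
    by (rule injI) (simp add: triple_mod_eq_iff)
  have "surj ?f"
    by (rule surjI[of _ "\<lambda>(a, b). of_sides a b"]) auto
  then have "dim (UNIV :: triple_mod set) = dim (UNIV :: ((real^2) \<times> (real^2)) set)"
    using dim_image_eq[OF lin, of UNIV] inj by simp
  then show ?thesis
    by (simp add: dim_UNIV)
qed

lemma triangle_space_iff:
  "p \<in> triangle_space \<longleftrightarrow> side2 p \<noteq> 0 \<and> side3 p \<noteq> 0 \<and> side3 p \<noteq> side2 p"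
proof -
  have tri: "P \<in> triangles \<longleftrightarrow> P $ 2 \<noteq> P $ 1 \<and> P $ 3 \<noteq> P $ 1 \<and> P $ 3 \<noteq> P $ 2" for P
    unfolding triangles_def mem_Collect_eq forall_3 by auto
  show ?thesis
  proof
    assume "p \<in> triangle_space"
    then show "side2 p \<noteq> 0 \<and> side3 p \<noteq> 0 \<and> side3 p \<noteq> side2 p"
      by (auto simp: triangle_space_def side2.abs_eq side3.abs_eq tri)
  next
    assume *: "side2 p \<noteq> 0 \<and> side3 p \<noteq> 0 \<and> side3 p \<noteq> side2 p"
    have "axis 2 (side2 p) + axis 3 (side3 p) \<in> triangles"
      using * unfolding tri by (simp add: axis_def)
    moreover have "p = abs_triple_mod (axis 2 (side2 p) + axis 3 (side3 p))"
      by (metis of_sides.abs_eq of_sides_side)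
    ultimately show "p \<in> triangle_space"
      unfolding triangle_space_def by blast
  qed
qed

lemma continuous_on_side: "continuous_on S side2" "continuous_on S side3"
  by (simp_all add: linear_continuous_on bounded_linear_side)

lemma open_triangle_space: "open triangle_space"
proof -
  have "triangle_space = {p. side2 p \<noteq> 0} \<inter> {p. side3 p \<noteq> 0} \<inter> {p. side3 p \<noteq> side2 p}"
    by (auto simp: triangle_space_iff)
  moreover have "open ({p. side2 p \<noteq> 0} \<inter> {p. side3 p \<noteq> 0} \<inter> {p. side3 p \<noteq> side2 p})"
    by (intro open_Int open_Collect_neq continuous_on_side continuous_on_const)
  ultimately show ?thesis
    by simp
qed

text \<open>The alternating signs are those in the expansion of \<open>(dx2 - dx1)\<close> wedge
  \<open>(dx3 - dx1)\<close>, and likewise for y. In side coordinates the form therefore has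
  constant coefficients.\<close>

lemma omega_mod_sides: "omega_mod p q = side2 p \<bullet> side3 q - side2 q \<bullet> side3 p"
proof transfer
  fix v w :: triple
  show "omega v w = (v $ 2 - v $ 1) \<bullet> (w $ 3 - w $ 1) - (w $ 2 - w $ 1) \<bullet> (v $ 3 - v $ 1)"
    by (simp add: omega_def wedge_def dx_def dy_def numeral_3_eq_3 atLeastLessThanSuc
        sum.atLeast_Suc_atMost_Suc_shift inner_vec_def sum_2 algebra_simps)
qed

lemma perimeter_mod_sides:
  "perimeter_mod p = norm (side2 p) + norm (side3 p - side2 p) + norm (side3 p)"
proof transfer
  fix P :: triple
  \<comment> \<open>The cyclic successor of the last index is the numeral 4, which wraps around to
    1.\<close>
  have four: "(4::3) = 1" by simp
  show "perimeter P = norm (P $ 2 - P $ 1) + norm (P $ 3 - P $ 1 - (P $ 2 - P $ 1)) + norm (P $ 3 - P $ 1)"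
    by (simp add: perimeter_def sum_3 four dist_norm norm_minus_commute)
qed

definition cross2 :: "real^2 \<Rightarrow> real^2 \<Rightarrow> real" where
  "cross2 a b = a $ 1 * b $ 2 - a $ 2 * b $ 1"

text \<open>The counterclockwise quarter turn. It turns the determinant \<open>cross2\<close> into
  an inner product.\<close>

definition rot2 :: "real^2 \<Rightarrow> real^2" where
  "rot2 a = vector [- (a $ 2), a $ 1]"

lemma inner_rot2: "rot2 a \<bullet> b = cross2 a b" "b \<bullet> rot2 a = cross2 a b"
  by (simp_all add: rot2_def cross2_def inner_vec_def sum_2)

lemma cross2_commute: "cross2 b a = - cross2 a b"
  and cross2_self: "cross2 a a = 0"
  by (simp_all add: cross2_def)

lemma bounded_bilinear_cross2: "bounded_bilinear cross2"
  unfolding bilinear_conv_bounded_bilinear[symmetric] bilinear_def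
  by (auto intro!: linearI simp: cross2_def algebra_simps)

lemma signed_area_mod_sides: "signed_area_mod p = (1/2) * cross2 (side2 p) (side3 p)"
proof transfer
  fix P :: triple
  have four: "(4::3) = 1" by simp
  show "signed_area P = (1/2) * cross2 (P $ 2 - P $ 1) (P $ 3 - P $ 1)"
    by (simp add: signed_area_def sum_3 four cross2_def algebra_simps)
qed

text \<open>Both ends of a side move with the same half unit vector along that side, so it cancels
  in the difference and only the other two directions remain.\<close>

lemma side_xi_mod:
  "side2 (xi_mod p) = (1/2) *\<^sub>R (sgn (side3 p - side2 p) + sgn (side3 p))"
  "side3 (xi_mod p) = (1/2) *\<^sub>R (sgn (side3 p - side2 p) - sgn (side2 p))"
proof -
  have idx: "(1::3) - 1 = 3" "(3::3) + 1 = 1" "(2::3) - 1 = 1" "(1::3) + 1 = 2"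
    "(3::3) - 1 = 2" "(2::3) + 1 = 3"
    by simp_all
  have flip: "sgn (a - b) = - sgn (b - a)" for a b :: "real^2"
    by (metis minus_diff_eq sgn_minus)
  have xi: "xi P $ 1 = (1/2) *\<^sub>R (sgn (P $ 2 - P $ 1) - sgn (P $ 3 - P $ 1))"
    "xi P $ 2 = (1/2) *\<^sub>R (sgn (P $ 2 - P $ 1) + sgn (P $ 3 - P $ 2))"
    "xi P $ 3 = (1/2) *\<^sub>R (sgn (P $ 3 - P $ 2) - sgn (P $ 3 - P $ 1))" for P
    unfolding xi_def vec_lambda_beta idx sgn_div_norm[symmetric]
      flip[of "P $ 1" "P $ 2"] flip[of "P $ 1" "P $ 3"] flip[of "P $ 2" "P $ 3"]
    by simp_all
  show "side2 (xi_mod p) = (1/2) *\<^sub>R (sgn (side3 p - side2 p) + sgn (side3 p))"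
    "side3 (xi_mod p) = (1/2) *\<^sub>R (sgn (side3 p - side2 p) - sgn (side2 p))"
    by (transfer; simp add: xi algebra_simps)+
qed

section \<open>The symplectic form and the two integrals\<close>

text \<open>No side of a triangle vanishes, so each length is differentiable, with the unit vector
  along the side as gradient.\<close>

lemma frechet_derivative_perimeter_mod:
  assumes "p \<in> triangle_space"
  shows "frechet_derivative perimeter_mod (at p) v =
    sgn (side2 p) \<bullet> side2 v + sgn (side3 p - side2 p) \<bullet> (side3 v - side2 v) + sgn (side3 p) \<bullet> side3 v"
proof -
  note side_deriv = bounded_linear_side[THEN bounded_linear.has_derivative, OF has_derivative_ident]
  have nz: "side2 p \<noteq> 0" "side3 p \<noteq> 0" "side3 p - side2 p \<noteq> 0"
    using assms by (auto simp: triangle_space_iff)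
  have norm: "((\<lambda>x. norm (f x)) has_derivative (\<lambda>v. f' v \<bullet> sgn (f p))) (at p)"
    if "(f has_derivative f') (at p)" "f p \<noteq> 0" for f :: "triple_mod \<Rightarrow> real^2" and f'
    using has_derivative_compose[OF that(1) has_derivative_norm[OF that(2)]] by simp
  have "(perimeter_mod has_derivative (\<lambda>v. side2 v \<bullet> sgn (side2 p)
      + (side3 v - side2 v) \<bullet> sgn (side3 p - side2 p) + side3 v \<bullet> sgn (side3 p))) (at p)"
    unfolding perimeter_mod_sides[abs_def]
    by (intro has_derivative_add norm has_derivative_diff side_deriv nz)
  from frechet_derivative_at[OF this, symmetric] show ?thesis
    by (simp add: inner_commute)
qed

lemma frechet_derivative_signed_area_mod:
  "frechet_derivative signed_area_mod (at p) v =
    (1/2) * (cross2 (side2 p) (side3 v) + cross2 (side2 v) (side3 p))"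
proof -
  have "(signed_area_mod has_derivative
      (\<lambda>v. (1/2) * (cross2 (side2 p) (side3 v) + cross2 (side2 v) (side3 p)))) (at p)"
    unfolding signed_area_mod_sides[abs_def]
    by (intro has_derivative_mult_right bounded_bilinear.FDERIV[OF bounded_bilinear_cross2]
        bounded_linear_side[THEN bounded_linear.has_derivative, OF has_derivative_ident])
  from frechet_derivative_at[OF this, symmetric] show ?thesis by simp
qed

lemma smooth_on_perimeter_mod: "smooth_on perimeter_mod triangle_space"
  unfolding smooth_on_def perimeter_mod_sides[abs_def]
  by (auto intro!: Ck_on_add Ck_on_norm_linear open_triangle_space bounded_linear_sub
      bounded_linear_side simp: triangle_space_iff)

lemma smooth_on_signed_area_mod: "smooth_on signed_area_mod triangle_space"
proof -
  have "bounded_linear (\<lambda>p. (1/2) *\<^sub>R rot2 (side2 p))"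
    unfolding linear_conv_bounded_linear[symmetric]
    by (rule linearI) (simp_all add: rot2_def side_add side_scaleR vec_eq_iff forall_2 algebra_simps)
  moreover have "signed_area_mod = (\<lambda>p. ((1/2) *\<^sub>R rot2 (side2 p)) \<bullet> side3 p)"
    by (simp add: fun_eq_iff signed_area_mod_sides inner_rot2)
  ultimately show ?thesis
    unfolding smooth_on_def
    using Ck_on_inner_linear[OF open_triangle_space _ bounded_linear_side(2)] by metis
qed

text \<open>Testing on vectors with one side zero separates the two components. The form with two
  vectors serves both nondegeneracy (with \<open>u' = 0\<close>) and the uniqueness behind the
  \<open>THE\<close> in \<open>hamiltonian_vector\<close>.\<close>

lemma omega_mod_nondegenerate:
  assumes "\<And>v. omega_mod u v = omega_mod u' v"
  shows "u = u'"
proof -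
  have "side2 u \<bullet> b - a \<bullet> side3 u = side2 u' \<bullet> b - a \<bullet> side3 u'" for a b
    using assms[of "of_sides a b"] by (simp add: omega_mod_sides)
  from this[where b = 0] this[where a = 0]
  have "\<forall>a. a \<bullet> side3 u = a \<bullet> side3 u'" "\<forall>b. side2 u \<bullet> b = side2 u' \<bullet> b"
    by simp_all
  then have "side3 u = side3 u'" "side2 u = side2 u'"
    by (simp_all only: vector_eq_ldot vector_eq_rdot)
  then show ?thesis
    by (simp add: triple_mod_eq_iff)
qed

lemma symplectic_form_on_omega_mod: "symplectic_form_on triangle_space (\<lambda>_. omega_mod)"
  unfolding symplectic_form_on_def
proof (intro conjI ballI allI impI)
  show "bilinear omega_mod"
    unfolding bilinear_def
    by (auto intro!: linearI
        simp: omega_mod_sides side_add side_scaleR inner_add_left inner_add_right algebra_simps)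
  show "u = 0" if "\<forall>v. omega_mod u v = 0" for u
    using omega_mod_nondegenerate[of u 0] that by (simp add: omega_mod_sides[of 0] side_zero)
  show "smooth_on (\<lambda>p. omega_mod u v) triangle_space" for u v
    by (simp add: smooth_on_def Ck_on_const open_triangle_space)
qed (simp_all add: open_triangle_space omega_mod_sides inner_commute)

lemma hamiltonian_vector_eqI:
  assumes "\<And>v. omega_mod u v = frechet_derivative F (at p) v"
  shows "hamiltonian_vector (\<lambda>_. omega_mod) F p = u"
  unfolding hamiltonian_vector_def
  by (rule the_equality) (simp_all add: assms omega_mod_nondegenerate)

text \<open>The unit vector along \<open>side3 p - side2 p\<close> occurs in both components of
  \<open>xi_mod p\<close>. Its two pairings combine to the variation of the third side.\<close>

lemma omega_mod_xi_mod:
  assumes "p \<in> triangle_space"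
  shows "omega_mod (xi_mod p) v = (1/2) * frechet_derivative perimeter_mod (at p) v"
  unfolding frechet_derivative_perimeter_mod[OF assms] omega_mod_sides side_xi_mod
  by (simp add: inner_add_left inner_diff_left inner_add_right inner_diff_right inner_commute
      algebra_simps)

lemma is_hamiltonian_field_xi_mod:
  "is_hamiltonian_field triangle_space (\<lambda>_. omega_mod) (\<lambda>p. perimeter_mod p / 2) xi_mod"
  unfolding is_hamiltonian_field_def
proof (intro conjI ballI allI)
  show "smooth_on (\<lambda>p. perimeter_mod p / 2) triangle_space"
    unfolding smooth_on_def divide_inverse
    by (intro allI Ck_on_mult Ck_on_const open_triangle_space
        smooth_on_perimeter_mod[unfolded smooth_on_def, rule_format])
next
  fix p v assume p: "p \<in> triangle_space"
  have "Ck_on (Suc 0) perimeter_mod triangle_space"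
    using smooth_on_perimeter_mod unfolding smooth_on_def by blast
  note has_derivative_mult_right[OF Ck_on_Suc_has_derivative[OF this p], of "1/2"]
  from frechet_derivative_at[OF this]
  have "frechet_derivative (\<lambda>p. perimeter_mod p / 2) (at p) v
      = (1/2) * frechet_derivative perimeter_mod (at p) v"
    by (simp add: fun_eq_iff)
  then show "omega_mod (xi_mod p) v = frechet_derivative (\<lambda>p. perimeter_mod p / 2) (at p) v"
    by (simp add: omega_mod_xi_mod[OF p])
qed

lemma hamiltonian_vector_perimeter_mod:
  assumes "p \<in> triangle_space"
  shows "hamiltonian_vector (\<lambda>_. omega_mod) perimeter_mod p = 2 *\<^sub>R xi_mod p"
proof (rule hamiltonian_vector_eqI)
  fix v
  have "omega_mod (2 *\<^sub>R xi_mod p) v = 2 * omega_mod (xi_mod p) v"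
    by (simp add: omega_mod_sides side_scaleR)
  then show "omega_mod (2 *\<^sub>R xi_mod p) v = frechet_derivative perimeter_mod (at p) v"
    by (simp add: omega_mod_xi_mod[OF assms])
qed

text \<open>The area generates the rotations of the triangle.\<close>

lemma hamiltonian_vector_signed_area_mod:
  "hamiltonian_vector (\<lambda>_. omega_mod) signed_area_mod p =
    (1/2) *\<^sub>R of_sides (rot2 (side2 p)) (rot2 (side3 p))"
  by (rule hamiltonian_vector_eqI)
    (simp add: omega_mod_sides side_scaleR frechet_derivative_signed_area_mod inner_rot2
      cross2_commute[of "side3 p"] algebra_simps)

lemma frechet_derivative_signed_area_mod_xi_mod:
  "frechet_derivative signed_area_mod (at p) (xi_mod p) = 0"
proof -
  interpret bounded_bilinear cross2 by (rule bounded_bilinear_cross2)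
  have sgn: "cross2 a (sgn a) = 0" "cross2 (sgn a) a = 0" for a
    by (simp_all add: sgn_div_norm scaleR_left scaleR_right cross2_self)
  \<comment> \<open>Once the products along the other two sides vanish, the derivative is a quarter
    of this product.\<close>
  have "cross2 (sgn (side3 p - side2 p)) (side3 p - side2 p) = 0"
    by (rule sgn)
  then show ?thesis
    unfolding frechet_derivative_signed_area_mod side_xi_mod
    by (simp add: scaleR_left scaleR_right add_left add_right diff_left diff_right sgn
        cross2_commute[of "side2 p"])
qed

text \<open>The bracket of area and perimeter is the derivative of the area along twice
  \<open>xi_mod\<close>, which vanishes. Antisymmetry of the form settles the other pairs.\<close>

lemma poisson_bracket_perimeter_signed_area:
  assumes "p \<in> triangle_space" "F \<in> {perimeter_mod, signed_area_mod}"
    "G \<in> {perimeter_mod, signed_area_mod}"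
  shows "poisson_bracket (\<lambda>_. omega_mod) F G p = 0"
proof -
  let ?X = "hamiltonian_vector (\<lambda>_. omega_mod) signed_area_mod p"
  have alt: "omega_mod u u = 0" and anti: "omega_mod v u = - omega_mod u v" for u v
    by (simp_all add: omega_mod_sides inner_commute)
  have X: "omega_mod ?X v = frechet_derivative signed_area_mod (at p) v" for v
    unfolding hamiltonian_vector_signed_area_mod frechet_derivative_signed_area_mod
    by (simp add: omega_mod_sides side_scaleR inner_rot2 cross2_commute[of "side3 p"] algebra_simps)
  have "omega_mod ?X (2 *\<^sub>R xi_mod p) = 2 * omega_mod ?X (xi_mod p)"
    by (simp add: omega_mod_sides side_scaleR algebra_simps)
  then have "omega_mod ?X (2 *\<^sub>R xi_mod p) = 0"
    by (simp add: X frechet_derivative_signed_area_mod_xi_mod)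
  then show ?thesis
    using assms anti[of "2 *\<^sub>R xi_mod p"]
    by (auto simp: poisson_bracket_def alt hamiltonian_vector_perimeter_mod)
qed

section \<open>Functional independence\<close>

text \<open>The differentials are dependent only at equilateral triangles; for density it is enough to
  exclude the triangles with two prescribed sides of equal length.\<close>

lemma sides_eq_if_critical:
  fixes a b :: "real^2"
  assumes "a \<noteq> 0" "b \<noteq> 0" "a \<noteq> b"
    and "(sgn a - sgn (b - a)) \<bullet> b = 0" "(sgn (b - a) + sgn b) \<bullet> a = 0"
  shows "norm a = norm b"
proof (rule ccontr)
  assume ne: "norm a \<noteq> norm b"
  define \<alpha> \<beta> L s where "\<alpha> = norm a" "\<beta> = norm b" "L = norm (b - a)" "s = a \<bullet> b"
  note defs = this
  have pos: "\<alpha> > 0" "\<beta> > 0" "L > 0"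
    using assms(1-3) by (simp_all add: defs)
  have sq: "a \<bullet> a = \<alpha>\<^sup>2" "b \<bullet> b = \<beta>\<^sup>2" "b \<bullet> a = s"
    by (simp_all add: defs power2_norm_eq_inner inner_commute)
  \<comment> \<open>This is the first critical equation,
    \<open>sgn a \<bullet> b = sgn (b - a) \<bullet> b\<close>, in terms of lengths and
    \<open>s\<close>.\<close>
  have "s / \<alpha> = (\<beta>\<^sup>2 - s) / L"
    using assms(4) unfolding sgn_div_norm
    by (simp add: inner_diff_left sq defs(1-3)[symmetric] defs(4)[symmetric] divide_inverse algebra_simps)
  then have e1: "s * L = \<alpha> * (\<beta>\<^sup>2 - s)"
    using pos by (simp add: field_simps)
  have "s / \<beta> = (\<alpha>\<^sup>2 - s) / L"
    using assms(5) unfolding sgn_div_norm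
    by (simp add: inner_add_left inner_diff_left sq defs(1-3)[symmetric] divide_inverse algebra_simps)
  then have e2: "s * L = \<beta> * (\<alpha>\<^sup>2 - s)"
    using pos by (simp add: field_simps)
  \<comment> \<open>The difference of \<open>e1\<close> and \<open>e2\<close> factors. Unequal
    lengths leave only antiparallel \<open>a\<close> and \<open>b\<close>, for which the two sides
    of \<open>e1\<close> have opposite signs.\<close>
  have "(\<beta> - \<alpha>) * (\<alpha> * \<beta> + s) = 0"
    using e1 e2 by (simp add: algebra_simps power2_eq_square)
  then have s: "s = - (\<alpha> * \<beta>)"
    using ne by (simp add: defs)
  have "s * L < 0" "\<alpha> * (\<beta>\<^sup>2 - s) > 0"
    using pos unfolding s by (simp_all add: add_pos_pos mult_pos_pos)
  then show False
    using e1 by simp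
qed

lemma differentials_independent_perimeter_signed_area:
  assumes p: "p \<in> triangle_space" and ne: "norm (side2 p) \<noteq> norm (side3 p)"
  shows "differentials_independent_at [perimeter_mod, signed_area_mod] p"
  unfolding differentials_independent_at_def
proof (intro allI impI)
  fix c :: "nat \<Rightarrow> real" and i
  assume "\<forall>v. (\<Sum>i<length [perimeter_mod, signed_area_mod]. c i *
      frechet_derivative ([perimeter_mod, signed_area_mod] ! i) (at p) v) = 0"
  then have dep: "c 0 * frechet_derivative perimeter_mod (at p) v
      + c 1 * frechet_derivative signed_area_mod (at p) v = 0" for v
    by (simp add: lessThan_Suc numeral_2_eq_2 add.commute)
  interpret bounded_bilinear cross2 by (rule bounded_bilinear_cross2)
  note D = frechet_derivative_perimeter_mod[OF p] frechet_derivative_signed_area_mod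
  let ?a = "side2 p" and ?b = "side3 p"
  have nz: "?a \<noteq> 0" "?b \<noteq> 0" "?a \<noteq> ?b"
    using p by (auto simp: triangle_space_iff)
  have "c 0 * ((sgn ?a - sgn (?b - ?a)) \<bullet> ?b) = 0"
    using dep[of "of_sides ?b 0"] by (simp add: D zero_right zero_left cross2_self inner_diff_left)
  moreover have "c 0 * ((sgn (?b - ?a) + sgn ?b) \<bullet> ?a) = 0"
    using dep[of "of_sides 0 ?a"] by (simp add: D zero_right zero_left cross2_self inner_add_left)
  ultimately have c0: "c 0 = 0"
    using sides_eq_if_critical[OF nz] ne by auto
  \<comment> \<open>Moving the third vertex perpendicularly to \<open>?a\<close> changes the area at
    the nonzero rate \<open>|?a|^2 / 2\<close>, which forces the remaining coefficient to
    vanish.\<close>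
  have "cross2 ?a (rot2 ?a) = ?a \<bullet> ?a"
    by (simp add: cross2_def rot2_def inner_vec_def sum_2)
  then have "c 1 = 0"
    using dep[of "of_sides 0 (rot2 ?a)"] nz by (simp add: D c0 zero_left)
  then show "i < length [perimeter_mod, signed_area_mod] \<Longrightarrow> c i = 0"
    using c0 by (auto simp: less_Suc_eq)
qed

lemma triangle_space_subset_closure_scalene:
  "triangle_space \<subseteq> closure {p \<in> triangle_space. norm (side2 p) \<noteq> norm (side3 p)}"
    (is "_ \<subseteq> closure ?W")
proof
  fix p assume p: "p \<in> triangle_space"
  show "p \<in> closure ?W"
  proof (cases "norm (side2 p) = norm (side3 p)")
    case True
    \<comment> \<open>Stretching \<open>side3 p\<close> by the factor \<open>1 + 1/(n + 1)\<close>
      destroys the equality of lengths for every \<open>n\<close>, and openness keeps the stretched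
      triple a triangle for large \<open>n\<close>.\<close>
    define d where "d = of_sides 0 (side3 p)"
    define q where "q n = p + inverse (real (Suc n)) *\<^sub>R d" for n
    have "(\<lambda>n. p + inverse (real (Suc n)) *\<^sub>R d) \<longlonglongrightarrow> p + 0 *\<^sub>R d"
      by (intro tendsto_intros LIMSEQ_inverse_real_of_nat)
    then have lim: "q \<longlonglongrightarrow> p"
      by (simp add: q_def[abs_def])
    have "eventually (\<lambda>n. q n \<in> triangle_space) sequentially"
      using lim open_triangle_space p by (rule topological_tendstoD)
    moreover have "norm (side2 (q n)) \<noteq> norm (side3 (q n))" for n
    proof -
      let ?c = "inverse (real (Suc n))"
      have "side2 (q n) = side2 p" "side3 (q n) = (1 + ?c) *\<^sub>R side3 p"
        by (simp_all add: q_def d_def side_add side_scaleR scaleR_add_left)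
      moreover have "norm ((1 + ?c) *\<^sub>R side3 p) = (1 + ?c) * norm (side3 p)"
        by (simp add: add_nonneg_nonneg)
      moreover have "norm (side3 p) > 0" "?c > 0"
        using p by (simp_all add: triangle_space_iff)
      ultimately show ?thesis
        using True by simp
    qed
    ultimately have "eventually (\<lambda>n. q n \<in> ?W) sequentially"
      by simp
    then show ?thesis
      using lim by (intro Lim_in_closed_set[OF closed_closure _ sequentially_bot lim])
        (auto elim!: eventually_mono intro: closure_subset[THEN subsetD])
  next
    case False
    with p have "p \<in> ?W" by simp
    then show ?thesis
      by (rule closure_subset[THEN subsetD])
  qed
qed

lemma liouville_integrable_xi_mod:
  "liouville_integrable_by triangle_space (\<lambda>_. omega_mod) xi_mod [perimeter_mod, signed_area_mod]"
  unfolding liouville_integrable_by_def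
proof (intro conjI)
  show "symplectic_form_on triangle_space (\<lambda>_. omega_mod)"
    by (rule symplectic_form_on_omega_mod)
  show "DIM(triple_mod) = 2 * length [perimeter_mod, signed_area_mod]"
    by (simp add: DIM_triple_mod)
  show "\<exists>H. is_hamiltonian_field triangle_space (\<lambda>_. omega_mod) H xi_mod"
    using is_hamiltonian_field_xi_mod by blast
  \<comment> \<open>A Hamiltonian is constant along its own field, because the form is
    alternating.\<close>
  have "frechet_derivative perimeter_mod (at p) (xi_mod p) = 0" if "p \<in> triangle_space" for p
    using omega_mod_xi_mod[OF that, of "xi_mod p"] by (simp add: omega_mod_sides)
  then show "\<forall>F\<in>set [perimeter_mod, signed_area_mod]. is_integral triangle_space xi_mod F"
    by (simp add: is_integral_def smooth_on_perimeter_mod smooth_on_signed_area_mod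
        frechet_derivative_signed_area_mod_xi_mod)
  show "\<forall>F\<in>set [perimeter_mod, signed_area_mod]. \<forall>G\<in>set [perimeter_mod, signed_area_mod].
      \<forall>p\<in>triangle_space. poisson_bracket (\<lambda>_. omega_mod) F G p = 0"
    using poisson_bracket_perimeter_signed_area by simp
  let ?W = "{p \<in> triangle_space. norm (side2 p) \<noteq> norm (side3 p)}"
  have "?W = triangle_space \<inter> {p. norm (side2 p) \<noteq> norm (side3 p)}"
    by auto
  then have "open ?W"
    by (simp add: open_Int open_triangle_space open_Collect_neq continuous_on_norm continuous_on_side)
  then show "\<exists>W. open W \<and> W \<subseteq> triangle_space \<and> triangle_space \<subseteq> closure W \<and>
      (\<forall>p\<in>W. differentials_independent_at [perimeter_mod, signed_area_mod] p)"
    using triangle_space_subset_closure_scalene differentials_independent_perimeter_signed_area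
    by (intro exI[of _ ?W]) auto
qed

section \<open>The area is preserved by the relation\<close>

text \<open>The claim is a polynomial identity in the coordinates that holds for arbitrary values \<open>l\<close>, \<open>m\<close>, \<open>n\<close>
  of the reciprocal side lengths.\<close>

lemma signed_area_q_map_eq_r_map: "signed_area (q_map t P) = signed_area (r_map t P)"
proof -
  have idx: "(1::3) - 1 = 3" "(3::3) + 1 = 1" "(2::3) - 1 = 1" "(1::3) + 1 = 2"
    "(3::3) - 1 = 2" "(2::3) + 1 = 3"
    by simp_all
  \<comment> \<open>The factor \<open>t\<close> is absorbed here. Each side carries a single
    coefficient: \<open>q_map\<close> extends the side beyond one end and \<open>r_map\<close>
    beyond the other by the same multiple.\<close>
  define l m n where "l = t * inverse (norm (P $ 2 - P $ 1))"
    "m = t * inverse (norm (P $ 3 - P $ 2))" "n = t * inverse (norm (P $ 3 - P $ 1))"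
  note lmn = this
  have Q: "q_map t P $ 1 = P $ 1 + n *\<^sub>R (P $ 1 - P $ 3)"
    "q_map t P $ 2 = P $ 2 + l *\<^sub>R (P $ 2 - P $ 1)"
    "q_map t P $ 3 = P $ 3 + m *\<^sub>R (P $ 3 - P $ 2)"
    unfolding q_map_def vec_lambda_beta idx lmn scaleR_scaleR[symmetric]
    by (simp_all only: norm_minus_commute)
  have R: "r_map t P $ 1 = P $ 1 + l *\<^sub>R (P $ 1 - P $ 2)"
    "r_map t P $ 2 = P $ 2 + m *\<^sub>R (P $ 2 - P $ 3)"
    "r_map t P $ 3 = P $ 3 + n *\<^sub>R (P $ 3 - P $ 1)"
    unfolding r_map_def vec_lambda_beta idx lmn scaleR_scaleR[symmetric]
    by (simp_all only: norm_minus_commute)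
  show ?thesis
    unfolding signed_area_def sum_3 idx Q R vector_add_component vector_scaleR_component
      vector_minus_component real_scaleR_def
    by algebra
qed

theorem theorem1:
  shows "liouville_integrable_by triangle_space (\<lambda>_. omega_mod) xi_mod
           [perimeter_mod, signed_area_mod] \<and>
         (\<forall>t>0. \<forall>Q R. t_related t Q R \<longrightarrow> signed_area Q = signed_area R)"
  using liouville_integrable_xi_mod
  by (auto simp: t_related_def signed_area_q_map_eq_r_map)

end
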